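(* Suppose that $n\ge2$, $v\in\mathbb R_{>0}^n$, and $v^\perp$ is spanned by sign vectors. Then the positive normal direction of $v^\perp$ (the ray spanned by $v$) has a unique primitive integer representative $p\in\mathbb Z_{>0}^n$, and $$\max_i p_i\le D_{01}(n-2)\le\frac{(n-1)^{(n-1)/2}}{2^{n-2}}.$$ Consequently, for each fixed $n$, only finitely many such positive directions exist, even before identifying vertex (coordinate) permutations.
   Context: Sign vectors are elements of $\{-1,1\}^n$; $v^\perp=\{x\in\mathbb R^n:v^\top x=0\}$ is spanned by sign vectors if $\operatorname{span}(v^\perp\cap\{-1,1\}^n)=v^\perp$. An integer vector is primitive if its coordinates have greatest common divisor one. $D_{01}(j)=\max\{|\det N|:N\in\{0,1\}^{j\times j}\}$ for $j\ge1$, and $D_{01}(0)=1$. *)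

theory Defs
  imports "Jordan_Normal_Form.Determinant" "HOL-Analysis.Analysis"
begin

no_notation vec_index (infixl "$" 100)

definition sign_vectors :: "(real^'n) set"
  where "sign_vectors = {x. \<forall>i. x $ i \<in> {-1, 1}}"

definition perp :: "real^'n \<Rightarrow> (real^'n) set"
  where "perp v = {x. inner v x = 0}"

definition spanned_by_sign_vectors :: "real^'n \<Rightarrow> bool"
  where "spanned_by_sign_vectors v \<longleftrightarrow> span (perp v \<inter> sign_vectors) = perp v"

definition primitive :: "int^'n \<Rightarrow> bool"
  where "primitive p \<longleftrightarrow> Gcd (range (\<lambda>i. p $ i)) = 1"

definition ray :: "real^'n \<Rightarrow> (real^'n) set"
  where "ray v = {t *\<^sub>R v | t. t \<ge> 0}"

(* The origin lies in every ray but is not primitive, since its coordinates have gcd 0. *)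
definition primitive_rep :: "real^'n \<Rightarrow> int^'n \<Rightarrow> bool"
  where "primitive_rep v p \<longleftrightarrow> primitive p \<and> (\<chi> i. real_of_int (p $ i)) \<in> ray v"

(* The matrix size j is a natural number rather than a type, so the determinant is
   the one on carrier-based matrices, not the one of HOL-Analysis. *)
definition D01 :: "nat \<Rightarrow> int"
  where "D01 j = (if j = 0 then 1
     else Max {\<bar>Determinant.det N\<bar> | N :: int mat. N \<in> carrier_mat j j \<and> elements_mat N \<subseteq> {0, 1}})"

end

theory Submission
  imports Defs
begin

text \<open>
  Let \<open>n = m + 2\<close> be the dimension. A hyperplane \<open>v\<^sup>\<bottom>\<close> spanned by sign vectors has a basis of \<open>m + 1\<close>
  sign vectors, and its normal direction is given by the maximal minors of the matrix of these basis
  vectors (Cramer's rule). Each minor is the determinant of a sign matrix of size \<open>m + 1\<close>. After negating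
  rows and columns so that the first row and column become 1, elimination turns it into \<open>\<plusminus> 2 ^ m\<close> times
  the determinant of a 0/1 matrix of size \<open>m\<close>. The common factor \<open>2 ^ m\<close> does not affect the direction, so
  a positive \<open>v\<close> is a positive real multiple of an integer vector \<open>q\<close> with \<open>0 < q $ i \<le> D01 m\<close>
  (\<open>positive_normal_of_sign_hyperplane\<close>). The vector \<open>q\<close> is a positive integer multiple of the primitive
  representative, which therefore obeys the same bound
  (\<open>primitive_rep_of_int_multiple\<close>), and only finitely many integer vectors satisfy it.

  The correspondence between 0/1 matrices and sign matrices works in both directions. Read backwards, it
  turns Hadamard's inequality for sign matrices of size \<open>m + 1\<close> into the numerical bound on \<open>D01 m\<close>
  (\<open>D01_le_Hadamard\<close>). Hadamard's inequality is proved for Gram determinants, by induction along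
  orthogonal projection (\<open>det_Gram_bounds\<close>).
\<close>

section \<open>Elimination and Hadamard's inequality\<close>

lemma det_scale_rows_cols:
  fixes M :: "'a::comm_ring_1 mat"
  assumes M: "M \<in> carrier_mat n n"
  shows "Determinant.det (Matrix.mat n n (\<lambda>(i,j). r i * c j * M $$ (i,j)))
    = (\<Prod>i<n. r i) * (\<Prod>j<n. c j) * Determinant.det M"
proof -
  have "(\<Prod>i = 0..<n. r i * c (p i) * M $$ (i, p i))
      = (\<Prod>i<n. r i) * (\<Prod>j<n. c j) * (\<Prod>i = 0..<n. M $$ (i, p i))"
    if p: "p permutes {0..<n}" for p
    using prod.permute[OF p, of c] by (simp add: prod.distrib atLeast0LessThan o_def)
  moreover have "p i < n" if "p permutes {0..<n}" "i < n" for p i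
    using permutes_in_image[OF that(1), of i] that(2) by simp
  ultimately show ?thesis
    using M by (simp add: Determinant.det_def sum_distrib_left mult.left_commute cong: prod.cong_simp sum.cong_simp)
qed

text \<open>Every matrix whose first column is a multiple of its corner entry \<open>a\<close> has this form, with \<open>D\<close> the
Schur complement of the corner; one step of block elimination splits off the factor \<open>a\<close>. Since the
first column is prescribed as \<open>y i * a\<close>, no division occurs and \<open>a = 0\<close> is included.\<close>

lemma det_Schur_complement:
  fixes a :: "'a::idom"
  assumes D: "D \<in> carrier_mat n n"
  shows "Determinant.det (Matrix.mat (Suc n) (Suc n) (\<lambda>(i,j).
      if i = 0 then (if j = 0 then a else x (j - 1))
      else (if j = 0 then y (i - 1) * a else y (i - 1) * x (j - 1) + D $$ (i - 1, j - 1))))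
    = a * Determinant.det D" (is "Determinant.det ?M = _")
proof -
  let ?X = "Matrix.mat 1 n (\<lambda>(i,j). x j)"
  let ?Y = "Matrix.mat n 1 (\<lambda>(i,j). y i)"
  let ?a = "Matrix.mat 1 1 (\<lambda>_. a)"
  let ?L = "four_block_mat (1\<^sub>m 1) (0\<^sub>m 1 n) ?Y (1\<^sub>m n)"
  let ?U = "four_block_mat ?a ?X (0\<^sub>m n 1) D"
  have "?L * ?U = four_block_mat (1\<^sub>m 1 * ?a + 0\<^sub>m 1 n * 0\<^sub>m n 1) (1\<^sub>m 1 * ?X + 0\<^sub>m 1 n * D)
      (?Y * ?a + 1\<^sub>m n * 0\<^sub>m n 1) (?Y * ?X + 1\<^sub>m n * D)"
    by (rule mult_four_block_mat) (use D in auto)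
  also have "\<dots> = ?M"
    using D by (intro eq_matI) (auto simp: scalar_prod_def)
  finally have "?M = ?L * ?U" ..
  moreover have "Determinant.det (?L * ?U) = Determinant.det ?L * Determinant.det ?U"
    by (rule det_mult[of _ "Suc n"]) (use D in \<open>auto intro!: carrier_matI\<close>)
  moreover have "Determinant.det ?L = 1"
    by (subst det_four_block_mat_upper_right_zero[of _ 1 _ n]) auto
  moreover have "Determinant.det ?U = a * Determinant.det D"
    by (subst det_four_block_mat_lower_left_zero[of _ 1 _ n]) (use D in \<open>auto simp: det_single\<close>)
  ultimately show ?thesis by simp
qed

text \<open>Subtracting from each later vector its projection onto the first one replaces the Gram matrix by the
Schur complement of its corner, which is again a Gram matrix and whose diagonal has only decreased.
Induction on the number of vectors then bounds the determinant by the product of the squared lengths.\<close>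

lemma det_Gram_bounds:
  fixes B :: "nat \<Rightarrow> nat \<Rightarrow> real"
  shows "0 \<le> Determinant.det (Matrix.mat n n (\<lambda>(i,j). \<Sum>k<N. B i k * B j k)) \<and>
    Determinant.det (Matrix.mat n n (\<lambda>(i,j). \<Sum>k<N. B i k * B j k)) \<le> (\<Prod>i<n. \<Sum>k<N. (B i k)\<^sup>2)"
proof (induction n arbitrary: B)
  case 0
  then show ?case by simp
next
  case (Suc n)
  define G where "G B i j = (\<Sum>k<N. B i k * B j k)" for B :: "nat \<Rightarrow> nat \<Rightarrow> real" and i j
  define a where "a = G B 0 0"
  \<comment> \<open>If the first vector vanishes then \<open>a = 0\<close>, and division by zero makes \<open>y i = 0\<close>: nothing is subtracted.\<close>
  define y where "y i = G B (Suc i) 0 / a" for i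
  define g where "g i k = B (Suc i) k - y i * B 0 k" for i k
  have G_sym: "G B i j = G B j i" for B i j
    by (simp add: G_def mult.commute)
  have G_diag: "G B i i = (\<Sum>k<N. (B i k)\<^sup>2)" for B i
    by (simp add: G_def power2_eq_square)
  have "G B i 0 = 0" if "a = 0" for i
  proof -
    have "\<forall>k<N. B 0 k = 0"
      using that by (simp add: a_def G_diag sum_nonneg_eq_0_iff)
    then show ?thesis by (simp add: G_def)
  qed
  then have ya: "G B (Suc i) 0 = y i * a" for i
    by (simp add: y_def)
  have Gg: "G g i j = G B (Suc i) (Suc j) - y i * y j * a" for i j
  proof -
    have "G g i j = G B (Suc i) (Suc j) - y j * G B (Suc i) 0 - y i * G B 0 (Suc j) + y i * y j * a"
      by (simp add: G_def g_def a_def algebra_simps sum.distrib sum_subtractf sum_distrib_left)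
    then show ?thesis
      by (simp add: ya G_sym[of B 0])
  qed
  let ?D = "Matrix.mat n n (\<lambda>(i,j). G g i j)"
  have "Matrix.mat (Suc n) (Suc n) (\<lambda>(i,j). G B i j)
      = Matrix.mat (Suc n) (Suc n) (\<lambda>(i,j).
          if i = 0 then (if j = 0 then a else G B 0 (Suc (j - 1)))
          else (if j = 0 then y (i - 1) * a
                else y (i - 1) * G B 0 (Suc (j - 1)) + ?D $$ (i - 1, j - 1)))"
    (is "?M = ?M'")
  proof (rule eq_matI)
    fix i j assume "i < dim_row ?M'" "j < dim_col ?M'"
    then show "?M $$ (i,j) = ?M' $$ (i,j)"
      by (cases i; cases j) (simp_all add: ya Gg G_sym[of B 0 "Suc _"] flip: a_def)
  qed simp_all
  then have det_eq: "Determinant.det (Matrix.mat (Suc n) (Suc n) (\<lambda>(i,j). G B i j)) = a * Determinant.det ?D"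
    by (simp only: det_Schur_complement[of ?D n a "\<lambda>j. G B 0 (Suc j)" y, OF mat_carrier])
  have a: "0 \<le> a"
    by (simp add: a_def G_diag sum_nonneg)
  have IH: "0 \<le> Determinant.det ?D" "Determinant.det ?D \<le> (\<Prod>i<n. G g i i)"
    using Suc.IH[of g] by (simp_all add: G_diag flip: G_def)
  note IH(2)
  also have "(\<Prod>i<n. G g i i) \<le> (\<Prod>i<n. G B (Suc i) (Suc i))"
  proof (intro prod_mono conjI)
    fix i
    show "0 \<le> G g i i" by (simp add: G_diag sum_nonneg)
    show "G g i i \<le> G B (Suc i) (Suc i)" using a by (simp add: Gg)
  qed
  finally have "a * Determinant.det ?D \<le> a * (\<Prod>i<n. G B (Suc i) (Suc i))"
    using a by (simp add: mult_left_mono)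
  then show ?case
    using a IH(1) det_eq
    by (simp add: prod.lessThan_Suc_shift a_def flip: G_def G_diag del: prod.lessThan_Suc)
qed

text \<open>The square of a determinant is the Gram determinant of the rows.\<close>

lemma Hadamard_inequality:
  fixes A :: "real mat"
  assumes A: "A \<in> carrier_mat n n"
  shows "(Determinant.det A)\<^sup>2 \<le> (\<Prod>i<n. \<Sum>k<n. (A $$ (i,k))\<^sup>2)"
proof -
  have "A * transpose_mat A = Matrix.mat n n (\<lambda>(i,j). \<Sum>k<n. A $$ (i,k) * A $$ (j,k))"
    using A by (intro eq_matI) (auto simp: scalar_prod_def atLeast0LessThan)
  moreover have "Determinant.det (A * transpose_mat A) = (Determinant.det A)\<^sup>2"
    using A by (simp add: det_mult[of A n] Determinant.det_transpose[OF A] power2_eq_square)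
  ultimately show ?thesis
    using det_Gram_bounds[where n = n and N = n and B = "\<lambda>i k. A $$ (i,k)"] by simp
qed

lemma elements_mat_subset_iff:
  assumes "A \<in> carrier_mat m n"
  shows "elements_mat A \<subseteq> X \<longleftrightarrow> (\<forall>i<m. \<forall>j<n. A $$ (i,j) \<in> X)"
  using assms by (auto dest!: subsetD intro: elements_matI)

text \<open>Size zero has to be excluded because \<open>0 powr 0 = 0\<close>, whereas the empty determinant is 1.\<close>

lemma abs_det_sign_matrix_le:
  fixes A :: "real mat"
  assumes "0 < n" and A: "A \<in> carrier_mat n n" and signs: "elements_mat A \<subseteq> {-1, 1}"
  shows "\<bar>Determinant.det A\<bar> \<le> real n powr (real n / 2)"
proof -
  have "(A $$ (i,k))\<^sup>2 = 1" if "i < n" "k < n" for i k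
    using signs that unfolding elements_mat_subset_iff[OF A] by fastforce
  then have "(Determinant.det A)\<^sup>2 \<le> real n ^ n"
    using Hadamard_inequality[OF A] by simp
  then have "\<bar>Determinant.det A\<bar> \<le> sqrt (real n ^ n)"
    using real_le_rsqrt[of "\<bar>Determinant.det A\<bar>"] by simp
  also have "\<dots> = real n powr (real n / 2)"
    using \<open>0 < n\<close> by (simp add: powr_half_sqrt_powr powr_realpow)
  finally show ?thesis .
qed

section \<open>Sign matrices and 0/1 matrices\<close>

text \<open>Replacing 0 by 1 and 1 by -1 and adding a border of ones gives a sign matrix whose corner has
Schur complement \<open>-2 N\<close>.\<close>

lemma det_border_01_matrix:
  fixes N :: "int mat"
  assumes N: "N \<in> carrier_mat m m"
  shows "Determinant.det (Matrix.mat (Suc m) (Suc m) (\<lambda>(i,j).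
      if i = 0 \<or> j = 0 then 1 else 1 - 2 * real_of_int (N $$ (i - 1, j - 1))))
    = (-2) ^ m * real_of_int (Determinant.det N)" (is "Determinant.det ?S = _")
proof -
  let ?R = "map_mat real_of_int N"
  have "?S = Matrix.mat (Suc m) (Suc m) (\<lambda>(i,j).
      if i = 0 then (if j = 0 then 1 else 1)
      else (if j = 0 then 1 * 1 else 1 * 1 + ((-2) \<cdot>\<^sub>m ?R) $$ (i - 1, j - 1)))"
    using N by (intro eq_matI) auto
  then have "Determinant.det ?S = Determinant.det ((-2) \<cdot>\<^sub>m ?R)"
    using det_Schur_complement[of "(-2) \<cdot>\<^sub>m ?R" m 1 "\<lambda>_. 1" "\<lambda>_. 1"] N by simp
  then show ?thesis
    using N by (simp add: of_int_hom.hom_det)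
qed

lemma sign_matrix_of_01_matrix:
  fixes N :: "int mat"
  assumes N: "N \<in> carrier_mat m m" and N01: "elements_mat N \<subseteq> {0, 1}"
  obtains S :: "real mat" where "S \<in> carrier_mat (Suc m) (Suc m)" "elements_mat S \<subseteq> {-1, 1}"
    "\<bar>Determinant.det S\<bar> = 2 ^ m * real_of_int \<bar>Determinant.det N\<bar>"
proof
  let ?S = "Matrix.mat (Suc m) (Suc m) (\<lambda>(i,j).
      if i = 0 \<or> j = 0 then 1 else 1 - 2 * real_of_int (N $$ (i - 1, j - 1)))"
  show "?S \<in> carrier_mat (Suc m) (Suc m)" by simp
  have "?S $$ (i,j) \<in> {-1, 1}" if "i < Suc m" "j < Suc m" for i j
    using that N01 unfolding elements_mat_subset_iff[OF N]
    by (cases i; cases j) auto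
  then show "elements_mat ?S \<subseteq> {-1, 1}"
    by (subst elements_mat_subset_iff[of _ "Suc m" "Suc m"]) auto
  show "\<bar>Determinant.det ?S\<bar> = 2 ^ m * real_of_int \<bar>Determinant.det N\<bar>"
    by (simp add: det_border_01_matrix[OF N] abs_mult power_abs)
qed

text \<open>Negating rows and columns changes a determinant only by a sign, and it brings every sign matrix to the
bordered form whose first row and column consist of ones. This is what divides the minors of a sign
matrix by a power of two.\<close>

lemma sign_matrix_to_01_matrix:
  fixes S :: "real mat"
  assumes S: "S \<in> carrier_mat (Suc m) (Suc m)" and signs: "elements_mat S \<subseteq> {-1, 1}"
  obtains N :: "int mat" where "N \<in> carrier_mat m m" "elements_mat N \<subseteq> {0, 1}"
    "\<bar>Determinant.det S\<bar> = 2 ^ m * real_of_int \<bar>Determinant.det N\<bar>"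
proof
  \<comment> \<open>The factor \<open>S $$ (0, 0)\<close> in \<open>c\<close> makes \<open>r 0 * c 0\<close> agree with the corner sign.\<close>
  define r where "r i = S $$ (i, 0)" for i
  define c where "c j = S $$ (0, j) * S $$ (0, 0)" for j
  let ?N = "Matrix.mat m m (\<lambda>(i,j). if r (Suc i) * c (Suc j) * S $$ (Suc i, Suc j) = 1 then 0 else 1) :: int mat"
  let ?B = "Matrix.mat (Suc m) (Suc m) (\<lambda>(i,j).
      if i = 0 \<or> j = 0 then 1 else 1 - 2 * real_of_int (?N $$ (i - 1, j - 1)))"
  show N: "?N \<in> carrier_mat m m" by simp
  show "elements_mat ?N \<subseteq> {0, 1}" by (auto simp: elements_mat_def)
  have S_cases: "S $$ (i,j) = -1 \<or> S $$ (i,j) = 1" if "i < Suc m" "j < Suc m" for i j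
    using signs that unfolding elements_mat_subset_iff[OF S] by auto
  have "S $$ (i,j) = r i * c j * ?B $$ (i,j)" if "i < Suc m" "j < Suc m" for i j
    using that S_cases[of i j] S_cases[of i 0] S_cases[of 0 j] S_cases[of 0 0]
    by (cases i; cases j) (auto simp: r_def c_def)
  then have "S = Matrix.mat (Suc m) (Suc m) (\<lambda>(i,j). r i * c j * ?B $$ (i,j))"
    using S by (intro eq_matI) simp_all
  then have "Determinant.det S = (\<Prod>i<Suc m. r i) * (\<Prod>j<Suc m. c j) * Determinant.det ?B"
    using det_scale_rows_cols[of ?B "Suc m" r c] by simp
  moreover have "\<bar>\<Prod>i<Suc m. r i\<bar> = 1"
    unfolding abs_prod r_def
  proof (intro prod.neutral ballI)
    fix i assume "i \<in> {..<Suc m}"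
    then show "\<bar>S $$ (i, 0)\<bar> = 1" using S_cases[of i 0] by auto
  qed
  moreover have "\<bar>\<Prod>j<Suc m. c j\<bar> = 1"
    unfolding abs_prod c_def
  proof (intro prod.neutral ballI)
    fix j assume "j \<in> {..<Suc m}"
    then show "\<bar>S $$ (0, j) * S $$ (0, 0)\<bar> = 1" using S_cases[of 0 j] S_cases[of 0 0] by auto
  qed
  ultimately show "\<bar>Determinant.det S\<bar> = 2 ^ m * real_of_int \<bar>Determinant.det ?N\<bar>"
    by (simp add: det_border_01_matrix[OF N] abs_mult power_abs del: prod.lessThan_Suc)
qed

text \<open>The maximum runs over finitely many matrices, so it is attained. For size 0 the conventional value 1
is the absolute determinant of the only (empty) matrix, which lets all sizes be treated alike.\<close>

lemma D01_extremal:
  shows D01_upper: "\<And>N. N \<in> carrier_mat j j \<Longrightarrow> elements_mat N \<subseteq> {0, 1} \<Longrightarrow> \<bar>Determinant.det N\<bar> \<le> D01 j"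
    and D01_attained: "\<exists>N. N \<in> carrier_mat j j \<and> elements_mat N \<subseteq> {0, 1} \<and> D01 j = \<bar>Determinant.det N\<bar>"
proof -
  let ?M = "{N :: int mat. N \<in> carrier_mat j j \<and> elements_mat N \<subseteq> {0, 1}}"
  let ?f = "\<lambda>T. Matrix.mat j j (\<lambda>p. if p \<in> T then 1 else 0) :: int mat"
  have zero_mem: "0\<^sub>m j j \<in> ?M"
    using elements_0_mat by auto
  have D01_Max: "D01 j = Max ((\<lambda>N. \<bar>Determinant.det N\<bar>) ` ?M)"
  proof (cases "j = 0")
    case True
    then have "(\<lambda>N. \<bar>Determinant.det N\<bar>) ` ?M = (\<lambda>_. 1) ` ?M"
      by (intro image_cong) (auto simp: det_dim_zero)
    also have "\<dots> = {1}"
      using zero_mem by blast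
    finally show ?thesis by (simp add: D01_def True)
  next
    case False
    then show ?thesis by (simp only: D01_def if_False setcompr_eq_image)
  qed
  have "?M \<subseteq> ?f ` Pow ({..<j} \<times> {..<j})"
  proof
    fix N assume N: "N \<in> ?M"
    then have Nj: "N \<in> carrier_mat j j" and "elements_mat N \<subseteq> {0, 1}"
      by blast+
    then have "N $$ (i,k) = 0 \<or> N $$ (i,k) = 1" if "i < j" "k < j" for i k
      using that by (simp add: elements_mat_subset_iff[OF Nj])
    then have "N = ?f {p \<in> {..<j} \<times> {..<j}. N $$ p = 1}"
      using Nj by (intro eq_matI) auto
    then show "N \<in> ?f ` Pow ({..<j} \<times> {..<j})" by blast
  qed
  then have fin: "finite ?M"
    by (rule finite_subset) simp
  then have "D01 j \<in> (\<lambda>N. \<bar>Determinant.det N\<bar>) ` ?M"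
    unfolding D01_Max using fin zero_mem by (intro Max_in) blast+
  then show "\<exists>N. N \<in> carrier_mat j j \<and> elements_mat N \<subseteq> {0, 1} \<and> D01 j = \<bar>Determinant.det N\<bar>"
    by auto
  show "\<bar>Determinant.det N\<bar> \<le> D01 j" if "N \<in> carrier_mat j j" "elements_mat N \<subseteq> {0, 1}" for N
    unfolding D01_Max using fin that by (intro Max_ge) auto
qed

text \<open>Hadamard's bound is applied not to the 0/1 matrix itself but to the sign matrix of one size larger,
which gains the factor \<open>2 ^ m\<close>.\<close>

lemma D01_le_Hadamard:
  "real_of_int (D01 m) \<le> real (Suc m) powr (real (Suc m) / 2) / 2 ^ m"
proof -
  obtain N where N: "N \<in> carrier_mat m m" "elements_mat N \<subseteq> {0, 1}" and D: "D01 m = \<bar>Determinant.det N\<bar>"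
    using D01_attained by blast
  obtain S :: "real mat" where S: "S \<in> carrier_mat (Suc m) (Suc m)" "elements_mat S \<subseteq> {-1, 1}"
    and det: "\<bar>Determinant.det S\<bar> = 2 ^ m * real_of_int \<bar>Determinant.det N\<bar>"
    by (rule sign_matrix_of_01_matrix[OF N])
  show ?thesis
    using abs_det_sign_matrix_le[OF _ S] by (simp add: D det field_simps)
qed

section \<open>Normals of hyperplanes spanned by sign vectors\<close>

text \<open>If \<open>w\<close> is orthogonal to all rows but the first, the adjugate expresses it through the cofactors of
the first row alone, and these do not involve that row.\<close>

lemma Cramer_unit_vector:
  fixes A :: "'a::comm_ring_1 mat"
  assumes A: "A \<in> carrier_mat n n" and w: "w \<in> carrier_vec n"
    and Aw: "\<And>i. i < n \<Longrightarrow> vec_index (A *\<^sub>v w) i = (if i = 0 then s else 0)"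
    and i: "i < n"
  shows "Determinant.det A * vec_index w i = s * cofactor A 0 i"
proof -
  have "A *\<^sub>v w = Matrix.vec n (\<lambda>i. if i = 0 then s else 0)"
    using A Aw by (intro eq_vecI) auto
  then have "vec_index (adj_mat A *\<^sub>v (A *\<^sub>v w)) i = (\<Sum>k\<in>{0..<n}. cofactor A k i * (if k = 0 then s else 0))"
    using A i by (simp add: adj_mat_def scalar_prod_def)
  also have "\<dots> = (\<Sum>k\<in>{0..<n}. if k = 0 then s * cofactor A 0 i else 0)"
    by (intro sum.cong) auto
  also have "\<dots> = s * cofactor A 0 i"
    using i by simp
  finally have "vec_index (adj_mat A *\<^sub>v (A *\<^sub>v w)) i = s * cofactor A 0 i" .
  moreover have "adj_mat A *\<^sub>v (A *\<^sub>v w) = (Determinant.det A \<cdot>\<^sub>m 1\<^sub>m n) *\<^sub>v w"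
    using A w adj_mat[OF A] by (simp flip: assoc_mult_mat_vec)
  moreover have "vec_index ((Determinant.det A \<cdot>\<^sub>m 1\<^sub>m n) *\<^sub>v w) i
      = (\<Sum>k\<in>{0..<n}. if k = i then Determinant.det A * vec_index w i else 0)"
    using w i by (simp add: scalar_prod_def mult_delta_left mult_delta_right eq_commute[of i])
  ultimately show ?thesis
    using i by simp
qed

text \<open>Put \<open>v\<close> on top of a basis of its orthogonal complement that consists of sign vectors. The resulting
square matrix sends \<open>v\<close> to a multiple of the first unit vector, so Cramer's rule makes the coordinates
of \<open>v\<close> proportional to minors of the sign matrix below the first row. Up to sign, each minor is
\<open>2 ^ m\<close> times a 0/1 determinant, and this power of two is a common factor that goes into the real
scalar \<open>t\<close>.\<close>

lemma positive_normal_of_sign_hyperplane: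
  fixes v :: "real^'n"
  assumes card: "CARD('n) = Suc (Suc m)" and pos: "\<And>i. v $ i > 0"
    and spanned: "spanned_by_sign_vectors v"
  obtains t :: real and q :: "int^'n"
  where "t > 0" "\<And>i. v $ i = t * real_of_int (q $ i)" "\<And>i. 0 < q $ i" "\<And>i. q $ i \<le> D01 m"
proof -
  define n where "n = Suc (Suc m)"
  have v0: "v \<noteq> 0" using pos by (metis less_irrefl zero_index)
  let ?V = "perp v \<inter> sign_vectors"
  have span_V: "span ?V = perp v"
    using spanned by (simp add: spanned_by_sign_vectors_def)
  then have "dim ?V = dim (perp v)"
    by (metis dim_span)
  also have "\<dots> = Suc m"
    using v0 card by (simp add: perp_def dim_hyperplane)
  finally have dim_V: "dim ?V = Suc m" .
  obtain B where B: "B \<subseteq> ?V" "independent B" "?V \<subseteq> span B" "card B = Suc m"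
    using basis_exists[of ?V] dim_V by metis
  obtain b where b: "bij_betw b {0..<Suc m} B"
    using ex_bij_betw_nat_finite[OF finiteI_independent[OF B(2)]] B(4) by auto
  obtain h :: "nat \<Rightarrow> 'n" where h: "bij_betw h {0..<n} UNIV"
    using ex_bij_betw_nat_finite[of "UNIV :: 'n set"] card by (auto simp: n_def)
  define rw where "rw i = (case i of 0 \<Rightarrow> v | Suc k \<Rightarrow> b k)" for i
  define A where "A = Matrix.mat n n (\<lambda>(i,j). rw i $ h j)"
  define X where "X x = Matrix.vec n (\<lambda>j. x $ h j)" for x :: "real^'n"
  have A: "A \<in> carrier_mat n n" by (simp add: A_def)
  have b_mem: "b k \<in> perp v" "b k \<in> sign_vectors" "b k \<in> B" if "k < Suc m" for k
    using bij_betw_apply[OF b] B(1) that by (auto simp: subset_iff)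
  have AX: "vec_index (A *\<^sub>v X x) i = inner (rw i) x" if "i < n" for i x
    using that sum.reindex_bij_betw[OF h, of "\<lambda>a. rw i $ a * x $ a"]
    by (simp add: A_def X_def scalar_prod_def inner_vec_def)
  \<comment> \<open>A kernel vector is orthogonal to \<open>v\<close>, so it lies in the hyperplane, and it is orthogonal to the basis of
    the hyperplane, hence to itself.\<close>
  have det: "Determinant.det A \<noteq> 0"
  proof
    assume "Determinant.det A = 0"
    then obtain u where u: "u \<in> carrier_vec n" "u \<noteq> 0\<^sub>v n" "A *\<^sub>v u = 0\<^sub>v n"
      using det_0_iff_vec_prod_zero[OF A] by blast
    define x :: "real^'n" where "x = (\<chi> a. vec_index u (inv_into {0..<n} h a))"
    have Xx: "X x = u"
      using u(1) bij_betw_imp_inj_on[OF h] by (intro eq_vecI) (auto simp: X_def x_def)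
    have ortho: "inner (rw i) x = 0" if "i < n" for i
      using AX[OF that, of x] that by (simp add: Xx u(3))
    have "x \<in> perp v"
      using ortho[of 0] by (simp add: perp_def rw_def n_def)
    then have "x \<in> span B"
      using span_V B(3) by (metis span_mono span_span subsetD)
    moreover have "orthogonal x y" if y: "y \<in> B" for y
    proof -
      obtain k where "k \<in> {0..<Suc m}" "y = b k"
        using b y unfolding bij_betw_def by blast
      then show ?thesis
        using ortho[of "Suc k"] by (simp add: rw_def n_def orthogonal_def inner_commute)
    qed
    ultimately have "x = 0"
      using orthogonal_to_span[of x B x] by (simp add: orthogonal_self)
    then have "u = 0\<^sub>v n"
      using Xx by (auto simp: X_def)
    with u(2) show False by simp
  qed
  define s where "s = inner v v"
  have s: "s > 0" using v0 by (simp add: s_def)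
  have AXv: "vec_index (A *\<^sub>v X v) i = (if i = 0 then s else 0)" if "i < n" for i
    using AX[OF that, of v] b_mem that
    by (cases i) (auto simp: rw_def s_def n_def perp_def inner_commute)
  have "\<exists>z. \<bar>Determinant.det A\<bar> * v $ a = s * 2 ^ m * real_of_int z \<and> z \<le> D01 m" for a
  proof -
    obtain i where i: "i < n" "a = h i"
      using h by (metis atLeastLessThan_iff bij_betw_iff_bijections iso_tuple_UNIV_I)
    let ?S = "mat_delete A 0 i"
    have S: "?S \<in> carrier_mat (Suc m) (Suc m)"
      using A by (simp add: mat_delete_def n_def)
    have "?S $$ (k,l) \<in> {-1, 1}" if "k < Suc m" "l < Suc m" for k l
      using that b_mem(2)[of k] by (simp add: mat_delete_def A_def n_def rw_def sign_vectors_def)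
    then have "elements_mat ?S \<subseteq> {-1, 1}"
      unfolding elements_mat_subset_iff[OF S] by blast
    then obtain N :: "int mat" where N: "N \<in> carrier_mat m m" "elements_mat N \<subseteq> {0, 1}"
      and det_S: "\<bar>Determinant.det ?S\<bar> = 2 ^ m * real_of_int \<bar>Determinant.det N\<bar>"
      by (rule sign_matrix_to_01_matrix[OF S])
    have "Determinant.det A * v $ a = s * cofactor A 0 i"
      using Cramer_unit_vector[OF A _ AXv i(1)] i by (simp add: X_def)
    from arg_cong[OF this, of abs]
    have "\<bar>Determinant.det A\<bar> * \<bar>v $ a\<bar> = \<bar>s\<bar> * \<bar>Determinant.det ?S\<bar>"
      by (simp add: cofactor_def power_abs abs_mult)
    then have "\<bar>Determinant.det A\<bar> * v $ a = s * 2 ^ m * real_of_int \<bar>Determinant.det N\<bar>"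
      using s pos[of a] det_S by simp
    then show ?thesis
      using D01_upper[OF N] by blast
  qed
  then obtain z where z: "\<And>a. \<bar>Determinant.det A\<bar> * v $ a = s * 2 ^ m * real_of_int (z a)" "\<And>a. z a \<le> D01 m"
    by metis
  define t where "t = s * 2 ^ m / \<bar>Determinant.det A\<bar>"
  have t: "t > 0"
    using s det by (simp add: t_def)
  have vt: "v $ a = t * real_of_int (z a)" for a
    using z(1)[of a] det by (simp add: t_def field_simps)
  have "0 < z a" for a
    using vt[of a] t pos[of a] by (simp add: zero_less_mult_iff)
  with t vt z(2) show thesis
    by (intro that[of t "\<chi> a. z a"]) simp_all
qed

section \<open>Primitive integer vectors on a ray\<close>

text \<open>Taking greatest common divisors over \<open>j\<close> on both sides of the proportionality, for fixed \<open>i\<close>,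
extracts the factors \<open>q $ i\<close> and \<open>p $ i\<close>.\<close>

lemma multiple_of_primitive:
  fixes p q :: "int^'n"
  assumes prim: "primitive p" and nonneg: "\<And>i. 0 \<le> p $ i" "\<And>i. 0 \<le> q $ i"
    and proportional: "\<And>i j. q $ i * p $ j = q $ j * p $ i"
  shows "q $ i = p $ i * Gcd (range (\<lambda>j. q $ j))"
proof -
  have "q $ i = Gcd ((*) (q $ i) ` range (\<lambda>j. p $ j))"
    using prim nonneg by (simp only: Gcd_mult) (simp add: primitive_def)
  also have "(*) (q $ i) ` range (\<lambda>j. p $ j) = (*) (p $ i) ` range (\<lambda>j. q $ j)"
    using proportional[of i] by (simp add: image_image mult.commute)
  also have "Gcd \<dots> = p $ i * Gcd (range (\<lambda>j. q $ j))"
    using nonneg by (simp only: Gcd_mult) (simp add: abs_mult)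
  finally show ?thesis .
qed

text \<open>Dividing \<open>q\<close> by the greatest common divisor of its coordinates gives a primitive representative.
Conversely, any representative times this divisor is \<open>q\<close>, which shows both uniqueness and
that its coordinates do not exceed those of \<open>q\<close>.\<close>

lemma primitive_rep_of_int_multiple:
  fixes v :: "real^'n" and q :: "int^'n"
  assumes t: "t > 0" and v: "\<And>i. v $ i = t * real_of_int (q $ i)" and q: "\<And>i. 0 < q $ i"
  shows "\<exists>!p. primitive_rep v p"
    and "primitive_rep v p \<Longrightarrow> 0 < p $ i \<and> p $ i \<le> q $ i"
proof -
  let ?g = "Gcd (range (\<lambda>i. q $ i))"
  have rep: "q $ i = p $ i * ?g \<and> 0 < p $ i \<and> 0 < ?g" if p: "primitive_rep v p" for p i
  proof -
    obtain c where c: "c \<ge> 0" "(\<chi> i. real_of_int (p $ i)) = c *\<^sub>R v"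
      using p by (auto simp: primitive_rep_def ray_def)
    then have pc: "real_of_int (p $ j) = c * t * real_of_int (q $ j)" for j
      using v[of j] by (metis mult.assoc real_scaleR_def vec_lambda_beta vector_scaleR_component)
    have "0 \<le> real_of_int (p $ j)" for j
      unfolding pc using c(1) t q[of j] by simp
    then have nonneg: "0 \<le> p $ j" for j by simp
    have "real_of_int (q $ j * p $ k) = real_of_int (q $ k * p $ j)" for j k
      by (simp add: pc)
    then have "q $ i = p $ i * ?g"
      using p q by (intro multiple_of_primitive nonneg) (auto simp: primitive_rep_def less_imp_le simp flip: of_int_mult)
    moreover have "0 \<le> ?g" by simp
    ultimately show ?thesis
      using nonneg[of i] q[of i] by (auto simp: zero_less_mult_iff)
  qed
  show "0 < p $ i \<and> p $ i \<le> q $ i" if "primitive_rep v p"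
    using rep[OF that, of i] mult_left_mono[of 1 ?g "p $ i"] by simp
  have g: "0 < ?g"
    using q by (metis Gcd_int_greater_eq_0 Gcd_0_iff image_subset_iff insertE less_irrefl order_le_less rangeI singletonD UNIV_I)
  define p where "p = (\<chi> i. q $ i div ?g)"
  have qp: "q $ i = ?g * p $ i" for i
    by (simp add: p_def Gcd_dvd)
  have "?g = Gcd ((*) ?g ` range (\<lambda>i. p $ i))"
    by (subst image_image) (simp flip: qp)
  also have "\<dots> = ?g * Gcd (range (\<lambda>i. p $ i))"
    by (simp only: Gcd_mult) (simp add: abs_mult)
  finally have "primitive p"
    unfolding primitive_def using g by (metis less_irrefl mult_cancel_left1)
  moreover have "(\<chi> i. real_of_int (p $ i)) = (1 / (t * real_of_int ?g)) *\<^sub>R v"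
  proof (rule vec_eq_iff[THEN iffD2], rule allI)
    fix i
    have "v $ i = t * (real_of_int ?g * real_of_int (p $ i))"
      unfolding v by (subst qp) simp
    then show "(\<chi> i. real_of_int (p $ i)) $ i = ((1 / (t * real_of_int ?g)) *\<^sub>R v) $ i"
      using t g by (simp del: Gcd_0_iff)
  qed
  then have "(\<chi> i. real_of_int (p $ i)) \<in> ray v"
    unfolding ray_def using t g by (auto intro!: exI[of _ "1 / (t * real_of_int ?g)"])
  ultimately have "primitive_rep v p"
    by (simp add: primitive_rep_def)
  then show "\<exists>!p. primitive_rep v p"
  proof (rule ex1I)
    fix p' assume "primitive_rep v p'"
    then have "p' $ i * ?g = p $ i * ?g" for i
      using rep \<open>primitive_rep v p\<close> by metis
    then show "p' = p"
      using g by (simp add: vec_eq_iff del: Gcd_0_iff)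
  qed
qed

lemma ray_scale:
  assumes "t > 0"
  shows "ray (t *\<^sub>R w) = ray w"
proof
  show "ray (t *\<^sub>R w) \<subseteq> ray w"
    using assms by (force simp: ray_def)
  show "ray w \<subseteq> ray (t *\<^sub>R w)"
  proof
    fix x assume "x \<in> ray w"
    then obtain c where "c \<ge> 0" "x = c *\<^sub>R w" by (auto simp: ray_def)
    then show "x \<in> ray (t *\<^sub>R w)"
      using assms by (auto simp: ray_def intro!: exI[of _ "c / t"])
  qed
qed

lemma finite_int_vectors:
  assumes "finite S"
  shows "finite {q :: int^'n. \<forall>i. q $ i \<in> S}"
proof (rule finite_subset)
  show "{q :: int^'n. \<forall>i. q $ i \<in> S} \<subseteq> vec_lambda ` (\<Pi>\<^sub>E i\<in>UNIV. S)"
    by (auto intro!: image_eqI[where x = "vec_nth _"])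
  show "finite (vec_lambda ` (\<Pi>\<^sub>E i\<in>UNIV. S) :: (int^'n) set)"
    using assms by (intro finite_imageI finite_PiE) auto
qed

section \<open>Bound on primitive normals\<close>

theorem proposition6p6:
  assumes "CARD('n::finite) \<ge> 2"
  shows "(\<forall>v :: real^'n. (\<forall>i. v $ i > 0) \<and> spanned_by_sign_vectors v \<longrightarrow>
        (\<exists>!p. primitive_rep v p) \<and>
        (\<forall>p. primitive_rep v p \<longrightarrow>
            (\<forall>i. p $ i > 0) \<and>
            (MAX i. p $ i) \<le> D01 (CARD('n) - 2)) \<and>
        real_of_int (D01 (CARD('n) - 2))
          \<le> real (CARD('n) - 1) powr (real (CARD('n) - 1) / 2) / 2 ^ (CARD('n) - 2)) \<and>
      finite {ray v | v :: real^'n. (\<forall>i. v $ i > 0) \<and> spanned_by_sign_vectors v}"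
proof (intro conjI allI impI)
  define m where "m = CARD('n) - 2"
  have card: "CARD('n) = Suc (Suc m)"
    using assms by (simp add: m_def)
  let ?good = "\<lambda>v :: real^'n. (\<forall>i. v $ i > 0) \<and> spanned_by_sign_vectors v"
  have normal: "\<exists>t q. t > 0 \<and> (\<forall>i. v $ i = t * real_of_int (q $ i)) \<and> (\<forall>i. 0 < q $ i \<and> q $ i \<le> D01 m)"
    if "?good v" for v :: "real^'n"
    using that by (metis positive_normal_of_sign_hyperplane[OF card])
  show "real_of_int (D01 (CARD('n) - 2))
      \<le> real (CARD('n) - 1) powr (real (CARD('n) - 1) / 2) / 2 ^ (CARD('n) - 2)"
    using D01_le_Hadamard[of m] by (simp add: card)
  show "\<exists>!p. primitive_rep v p" if "?good v" for v
    using normal[OF that] primitive_rep_of_int_multiple(1) by metis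
  have bounds: "0 < p $ i \<and> p $ i \<le> D01 m" if "?good v" "primitive_rep v p" for v p i
    using normal[OF that(1)] primitive_rep_of_int_multiple(2)[OF _ _ _ that(2)] by (metis order_trans)
  show "0 < p $ i" if "?good v" "primitive_rep v p" for v p i
    using bounds[OF that] by blast
  show "(MAX i. p $ i) \<le> D01 (CARD('n) - 2)" if "?good v" "primitive_rep v p" for v p
    using bounds[OF that] by (simp add: m_def)
  have "{ray v | v. ?good v} \<subseteq>
      (\<lambda>q. ray (\<chi> i. real_of_int (q $ i))) ` {q :: int^'n. \<forall>i. q $ i \<in> {0..D01 m}}"
  proof clarify
    fix v :: "real^'n" assume "\<forall>i. v $ i > 0" "spanned_by_sign_vectors v"
    then obtain t and q :: "int^'n" where t: "t > 0" and v: "\<And>i. v $ i = t * real_of_int (q $ i)"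
      and q: "\<And>i. 0 < q $ i \<and> q $ i \<le> D01 m"
      using normal by blast
    have "v = t *\<^sub>R (\<chi> i. real_of_int (q $ i))"
      by (simp add: vec_eq_iff v)
    then have "ray v = ray (\<chi> i. real_of_int (q $ i))"
      using ray_scale[OF t] by simp
    moreover have "q \<in> {q. \<forall>i. q $ i \<in> {0..D01 m}}"
      using q by (simp add: less_imp_le)
    ultimately show "ray v \<in> (\<lambda>q. ray (\<chi> i. real_of_int (q $ i))) ` {q :: int^'n. \<forall>i. q $ i \<in> {0..D01 m}}"
      by blast
  qed
  then show "finite {ray v | v. ?good v}"
    by (rule finite_subset) (intro finite_imageI finite_int_vectors finite_atLeastAtMost_int)
qed

end
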